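(* Let $n \geq 1$ be an integer and let $\{X_t : t \geq 0\}$ be the Markov chain on $\{0,1,\ldots,n\}$ with $X_0 = 0$ and transition probabilities $$\mathbb{P}[X_{t+1} = i \mid X_t = i] = \frac{i}{n} \quad (0 \leq i \leq n), \qquad \mathbb{P}[X_{t+1} = i+1 \mid X_t = i] = \frac{n-i}{n} \quad (0 \leq i \leq n-1),$$ all other transition probabilities being $0$. Let $\tau_{fig} = \min\{t \geq 0 \mid X_t = n\}$. Then for every real $c > 0$, $$\mathbb{P}\big(\tau_{fig} > \lceil n \ln n + cn \rceil\big) \leq e^{-c}.$$
   Context: The chain models a collector completing an album of $n$ distinct stickers by buying stickers one at a time: each purchased sticker is, independently of the previous purchases, uniformly distributed among the $n$ stickers, and $X_t$ is the number of distinct stickers obtained after $t$ purchases (so $X_0 = 0$). The random variable $\tau_{fig}$ is the first time at which the album is complete. A Markov chain on a finite set $\Omega$ is a sequence of $\Omega$-valued random variables $\{X_t : t \geq 0\}$ such that $\mathbb{P}[X_{t+1} = y \mid X_0 = x_0, X_1 = x_1, \ldots, X_t = x] = \mathbb{P}[X_{t+1} = y \mid X_t = x]$ for all $t$ and all $x, y \in \Omega$, whenever $\mathbb{P}(X_0 = x_0, \ldots, X_t = x) \neq 0$. Here $\ln$ is the natural logarithm and, for $a \in \mathbb{R}$, $\lceil a \rceil$ is the smallest integer greater than or equal to $a$. *)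

theory Defs
  imports "HOL-Probability.Probability" "HOL-Library.Extended_Nat"
begin

(* Measurability into count_space S includes that X t takes values in S on space M. *)
definition markov_chain_on :: "'a measure \<Rightarrow> 's set \<Rightarrow> (nat \<Rightarrow> 'a \<Rightarrow> 's) \<Rightarrow> bool" where
  "markov_chain_on M S X \<longleftrightarrow>
     prob_space M \<and> finite S \<and> (\<forall>t. X t \<in> measurable M (count_space S)) \<and>
     (\<forall>t. \<forall>x. \<forall>y\<in>S. (\<forall>s\<le>t. x s \<in> S) \<longrightarrow>
        \<P>(\<omega> in M. \<forall>s\<le>t. X s \<omega> = x s) \<noteq> 0 \<longrightarrow>
        \<P>(\<omega> in M. X (Suc t) \<omega> = y \<bar> \<forall>s\<le>t. X s \<omega> = x s) =
        \<P>(\<omega> in M. X (Suc t) \<omega> = y \<bar> X t \<omega> = x t))"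

(* The library's conditional probability is 0 when the conditioning event is null, so
   transition probabilities are only prescribed for states of positive probability. *)
definition has_transition_probs ::
  "'a measure \<Rightarrow> 's set \<Rightarrow> (nat \<Rightarrow> 'a \<Rightarrow> 's) \<Rightarrow> ('s \<Rightarrow> 's \<Rightarrow> real) \<Rightarrow> bool" where
  "has_transition_probs M S X P \<longleftrightarrow>
     (\<forall>t. \<forall>x\<in>S. \<forall>y\<in>S. \<P>(\<omega> in M. X t \<omega> = x) \<noteq> 0 \<longrightarrow>
        \<P>(\<omega> in M. X (Suc t) \<omega> = y \<bar> X t \<omega> = x) = P x y)"

definition coupon_transition :: "nat \<Rightarrow> nat \<Rightarrow> nat \<Rightarrow> real" where
  "coupon_transition n i j =
     (if j = i then real i / real n
      else if j = i + 1 then (real n - real i) / real n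
      else 0)"

(* Equal to \<infinity> when the state is never reached. *)
definition hitting_time :: "(nat \<Rightarrow> 'a \<Rightarrow> 's) \<Rightarrow> 's \<Rightarrow> 'a \<Rightarrow> enat" where
  "hitting_time X y \<omega> = Inf {enat t | t. X t \<omega> = y}"

end

(* The expected number of missing stickers is multiplied by 1 - 1/n at each purchase, so after
   t purchases it is at most n (1 - 1/n)^t \<le> n exp (- t / n). Markov's inequality bounds the
   probability that some sticker is still missing. *)
theory Submission
  imports Defs
begin

text \<open>Law of total probability: measurability into \<open>count_space S\<close> forces the
  values of \<open>f\<close> into \<open>S\<close>, so its fibres partition the space.\<close>

lemma prob_eq_sum_prob_conj:
  assumes "prob_space M" "finite S" "f \<in> measurable M (count_space S)"
    and "{\<omega> \<in> space M. P \<omega>} \<in> sets M"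
  shows "\<P>(\<omega> in M. P \<omega>) = (\<Sum>x\<in>S. \<P>(\<omega> in M. P \<omega> \<and> f \<omega> = x))"
proof -
  interpret prob_space M by fact
  have meas: "{\<omega> \<in> space M. P \<omega> \<and> f \<omega> = x} \<in> sets M" if "x \<in> S" for x
  proof -
    have "{\<omega> \<in> space M. P \<omega> \<and> f \<omega> = x} = {\<omega> \<in> space M. P \<omega>} \<inter> (f -` {x} \<inter> space M)"
      by auto
    then show ?thesis
      using assms that by (auto intro!: sets.Int measurable_sets)
  qed
  have "{\<omega> \<in> space M. P \<omega>} = (\<Union>x\<in>S. {\<omega> \<in> space M. P \<omega> \<and> f \<omega> = x})"
    using measurable_space[OF assms(3)] by auto
  then show ?thesis
    using \<open>finite S\<close> meas
    by (auto simp: disjoint_family_on_def intro!: finite_measure_finite_Union)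
qed

lemma measurable_count_space_eq_set:
  assumes "f \<in> measurable M (count_space S)" "x \<in> S"
  shows "{\<omega> \<in> space M. f \<omega> = x} \<in> sets M"
proof -
  have "{\<omega> \<in> space M. f \<omega> = x} = f -` {x} \<inter> space M" by auto
  then show ?thesis using assms by (auto intro: measurable_sets)
qed

text \<open>Forward equation for the law of the chain: split the event at time \<open>Suc t\<close>
  according to the state at time \<open>t\<close>.\<close>

lemma prob_Suc_eq_sum_transition:
  assumes mc: "markov_chain_on M S X" and tr: "has_transition_probs M S X P" and y: "y \<in> S"
  shows "\<P>(\<omega> in M. X (Suc t) \<omega> = y) = (\<Sum>x\<in>S. \<P>(\<omega> in M. X t \<omega> = x) * P x y)"
proof -
  interpret prob_space M using mc by (simp add: markov_chain_on_def)
  have fin: "finite S" and meas: "\<And>t. X t \<in> measurable M (count_space S)"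
    using mc by (auto simp: markov_chain_on_def)
  have step: "\<P>(\<omega> in M. X (Suc t) \<omega> = y \<and> X t \<omega> = x) = \<P>(\<omega> in M. X t \<omega> = x) * P x y"
    if x: "x \<in> S" for x
  \<comment> \<open>Transition probabilities are prescribed only at states of positive probability;
    at a null state both sides vanish.\<close>
  proof (cases "\<P>(\<omega> in M. X t \<omega> = x) = 0")
    case True
    have "\<P>(\<omega> in M. X (Suc t) \<omega> = y \<and> X t \<omega> = x) \<le> \<P>(\<omega> in M. X t \<omega> = x)"
      by (intro finite_measure_mono measurable_count_space_eq_set[OF meas x]) auto
    with True show ?thesis by (simp add: measure_le_0_iff)
  next
    case False
    then have "\<P>(\<omega> in M. X (Suc t) \<omega> = y \<bar> X t \<omega> = x) = P x y"
      using tr x y by (simp add: has_transition_probs_def)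
    with False show ?thesis by (simp add: cond_prob_def field_simps)
  qed
  show ?thesis
    using prob_eq_sum_prob_conj[OF prob_space_axioms fin meas[of t]
        measurable_count_space_eq_set[OF meas[of "Suc t"] y]] step
    by simp
qed

text \<open>From state \<open>x\<close> the number of missing stickers drops by one with probability
  (n - x)/n, so its mean falls by a fraction 1/n of itself. Thus n - x is an eigenfunction of the
  transition matrix.\<close>

lemma coupon_transition_missing:
  assumes "x \<le> n" "n \<ge> 1"
  shows "(\<Sum>y\<in>{0..n}. (real n - real y) * coupon_transition n x y)
       = (1 - 1 / real n) * (real n - real x)"
proof -
  have "(\<Sum>y\<in>{0..n}. (real n - real y) * coupon_transition n x y)
      = (\<Sum>y\<in>{0..n}. (if y = x then (real n - real x) * (real x / real n) else 0)
          + (if y = x + 1 then (real n - real (x + 1)) * ((real n - real x) / real n) else 0))"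
    by (intro sum.cong) (auto simp: coupon_transition_def)
  also have "\<dots> = (real n - real x) * (real x / real n)
      + (real n - real (x + 1)) * ((real n - real x) / real n)"
    \<comment> \<open>For x = n the target x + 1 lies outside the range of summation, but its term
      carries the factor n - x = 0.\<close>
    using assms by (auto simp: sum.distrib not_le less_Suc_eq_le dest: le_antisym)
  also have "\<dots> = (1 - 1 / real n) * (real n - real x)"
    using assms by (simp add: field_simps)
  finally show ?thesis .
qed

lemma expected_missing_coupons_le:
  assumes n: "n \<ge> 1" and mc: "markov_chain_on M {0..n} X"
    and tr: "has_transition_probs M {0..n} X (coupon_transition n)"
  shows "(\<Sum>x\<in>{0..n}. (real n - real x) * \<P>(\<omega> in M. X t \<omega> = x))
       \<le> real n * (1 - 1 / real n) ^ t"
proof (induction t)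
  case 0
  interpret prob_space M using mc by (simp add: markov_chain_on_def)
  have "(\<Sum>x\<in>{0..n}. (real n - real x) * \<P>(\<omega> in M. X 0 \<omega> = x))
      \<le> (\<Sum>x\<in>{0..n}. real n * \<P>(\<omega> in M. X 0 \<omega> = x))"
    by (intro sum_mono mult_right_mono) auto
  also have "\<dots> = real n * (\<Sum>x\<in>{0..n}. \<P>(\<omega> in M. X 0 \<omega> = x))"
    by (simp add: sum_distrib_left)
  also have "(\<Sum>x\<in>{0..n}. \<P>(\<omega> in M. X 0 \<omega> = x)) = 1"
    using prob_eq_sum_prob_conj[OF prob_space_axioms, of "{0..n}" "X 0" "\<lambda>_. True"] mc
    by (simp add: markov_chain_on_def prob_space)
  finally show ?case by simp
next
  case (Suc t)
  let ?p = "\<lambda>x. \<P>(\<omega> in M. X t \<omega> = x)"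
  have "(\<Sum>y\<in>{0..n}. (real n - real y) * \<P>(\<omega> in M. X (Suc t) \<omega> = y))
      = (\<Sum>y\<in>{0..n}. \<Sum>x\<in>{0..n}. ?p x * ((real n - real y) * coupon_transition n x y))"
    by (intro sum.cong refl)
       (simp add: prob_Suc_eq_sum_transition[OF mc tr] sum_distrib_left mult_ac)
  \<comment> \<open>Summing over the new state first isolates the one-step mean from each
    \<open>x\<close>, to which the eigenfunction identity applies.\<close>
  also have "\<dots> = (\<Sum>x\<in>{0..n}. ?p x * (\<Sum>y\<in>{0..n}. (real n - real y) * coupon_transition n x y))"
    by (subst sum.swap) (simp only: sum_distrib_left)
  also have "\<dots> = (\<Sum>x\<in>{0..n}. (1 - 1 / real n) * ((real n - real x) * ?p x))"
    using n by (intro sum.cong refl) (subst coupon_transition_missing, auto)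
  also have "\<dots> = (1 - 1 / real n) * (\<Sum>x\<in>{0..n}. (real n - real x) * ?p x)"
    by (simp only: sum_distrib_left)
  also have "\<dots> \<le> (1 - 1 / real n) * (real n * (1 - 1 / real n) ^ t)"
    using n Suc.IH by (intro mult_left_mono) auto
  finally show ?case by (simp add: mult_ac)
qed

lemma hitting_time_le: "X t \<omega> = y \<Longrightarrow> hitting_time X y \<omega> \<le> enat t"
  unfolding hitting_time_def by (auto intro: Inf_lower)

text \<open>If state \<open>n\<close> is not hit by time \<open>t\<close>, then X t < n. Only this
  inclusion is used; the converse would rest on \<open>n\<close> being absorbing.\<close>

lemma prob_hitting_time_gt_le:
  assumes n: "n \<ge> 1" and mc: "markov_chain_on M {0..n} X"
    and tr: "has_transition_probs M {0..n} X (coupon_transition n)"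
  shows "\<P>(\<omega> in M. hitting_time X n \<omega> > enat t) \<le> real n * (1 - 1 / real n) ^ t"
proof -
  interpret prob_space M using mc by (simp add: markov_chain_on_def)
  have meas: "X t \<in> measurable M (count_space {0..n})"
    using mc by (simp add: markov_chain_on_def)
  note eq_sets = measurable_count_space_eq_set[OF meas]
  \<comment> \<open>Monotonicity asks for measurability of the larger set only, so the hitting-time
    event itself is never shown measurable.\<close>
  have "\<P>(\<omega> in M. hitting_time X n \<omega> > enat t) \<le> measure M (\<Union>x\<in>{0..<n}. {\<omega> \<in> space M. X t \<omega> = x})"
  proof (rule finite_measure_mono)
    show "{\<omega> \<in> space M. hitting_time X n \<omega> > enat t} \<subseteq> (\<Union>x\<in>{0..<n}. {\<omega> \<in> space M. X t \<omega> = x})"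
    proof safe
      fix \<omega> assume "\<omega> \<in> space M" and *: "hitting_time X n \<omega> > enat t"
      then have "X t \<omega> \<le> n" "X t \<omega> \<noteq> n"
        using measurable_space[OF meas] hitting_time_le[of X t \<omega> n] by (auto simp: not_le[symmetric])
      with \<open>\<omega> \<in> space M\<close> show "\<omega> \<in> (\<Union>x\<in>{0..<n}. {\<omega> \<in> space M. X t \<omega> = x})" by auto
    qed
  qed (use eq_sets in auto)
  also have "\<dots> \<le> (\<Sum>x\<in>{0..<n}. \<P>(\<omega> in M. X t \<omega> = x))"
    by (intro finite_measure_subadditive_finite) (use eq_sets in auto)
  \<comment> \<open>Markov's inequality at threshold 1: the missing count is an integer, hence at
    least 1 below \<open>n\<close>.\<close>
  also have "\<dots> \<le> (\<Sum>x\<in>{0..<n}. (real n - real x) * \<P>(\<omega> in M. X t \<omega> = x))"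
  proof (rule sum_mono)
    fix x assume "x \<in> {0..<n}"
    then have "1 \<le> real n - real x" by auto
    then show "\<P>(\<omega> in M. X t \<omega> = x) \<le> (real n - real x) * \<P>(\<omega> in M. X t \<omega> = x)"
      using mult_right_mono[of 1 "real n - real x" "\<P>(\<omega> in M. X t \<omega> = x)"] by simp
  qed
  also have "\<dots> \<le> (\<Sum>x\<in>{0..n}. (real n - real x) * \<P>(\<omega> in M. X t \<omega> = x))"
    by (intro sum_mono2) auto
  also have "\<dots> \<le> real n * (1 - 1 / real n) ^ t"
    by (rule expected_missing_coupons_le[OF assms])
  finally show ?thesis .
qed

theorem mainTheorem1:
  fixes M :: "'a measure" and X :: "nat \<Rightarrow> 'a \<Rightarrow> nat" and n :: nat and c :: real
  assumes "n \<ge> 1"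
    and "markov_chain_on M {0..n} X"
    and "AE \<omega> in M. X 0 \<omega> = 0"
    and "has_transition_probs M {0..n} X (coupon_transition n)"
    and "c > 0"
  shows "\<P>(\<omega> in M. hitting_time X n \<omega> > enat (nat \<lceil>real n * ln (real n) + c * real n\<rceil>)) \<le> exp (- c)"
proof -
  define t where "t = nat \<lceil>real n * ln (real n) + c * real n\<rceil>"
  have n: "real n > 0" using assms(1) by simp
  \<comment> \<open>Neither the ceiling nor \<open>nat\<close> can lower the value, so no sign check
    is needed.\<close>
  have "real n * ln (real n) + c * real n \<le> real t"
    unfolding t_def by linarith
  then have t: "ln (real n) + c \<le> real t / real n"
    using n by (simp add: field_simps)
  have "\<P>(\<omega> in M. hitting_time X n \<omega> > enat t) \<le> real n * (1 - 1 / real n) ^ t"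
    using assms by (intro prob_hitting_time_gt_le)
  \<comment> \<open>This is 1 + u \<le> exp u at u = -1/n; taking powers requires 1 - 1/n \<ge> 0,
    which follows from n \<ge> 1.\<close>
  also have "\<dots> \<le> real n * exp (- 1 / real n) ^ t"
    using assms(1) exp_ge_add_one_self[of "- 1 / real n"]
    by (intro mult_left_mono power_mono) auto
  also have "\<dots> = exp (ln (real n) - real t / real n)"
  proof -
    have "exp (- 1 / real n) ^ t = exp (- (real t / real n))"
      by (simp flip: exp_of_nat_mult)
    then show ?thesis
      using n by (simp add: exp_diff exp_minus divide_inverse)
  qed
  \<comment> \<open>The n ln n part of \<open>t\<close> cancels the factor \<open>n\<close>, and the
    c n part leaves the exponent at most -c.\<close>
  also have "\<dots> \<le> exp (- c)"
    using t by simp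
  finally show ?thesis unfolding t_def .
qed

end
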